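(* Let $(f_n)$ be a sequence of holomorphic maps $f_n:\mathbb{D}\to\mathbb{D}$ of the unit disk $\mathbb{D}$ such that $$f_n^h(z_n)=1+o\big((1-|z_n|)^2\big)$$ for some sequence $(z_n)$ in $\mathbb{D}$ with $|z_n|\to1$. Then (a) $f_n^h\to1$ locally uniformly in $\mathbb{D}$, and (b) every locally uniform subsequential limit of $(f_n)$ is either a unit disk automorphism or a unimodular constant.
   Context: For a holomorphic selfmap $f$ of $\mathbb{D}=\{|z|<1\}$, $f^h(z):=(1-|z|^2)\frac{|f'(z)|}{1-|f(z)|^2}$ for $z\in\mathbb{D}$. *)

theory Defs
  imports "HOL-Complex_Analysis.Complex_Analysis" "HOL-Library.Landau_Symbols"
begin

abbreviation unit_disk :: "complex set" where
  "unit_disk \<equiv> ball 0 1"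

definition holomorphic_self_map :: "complex set \<Rightarrow> (complex \<Rightarrow> complex) \<Rightarrow> bool" where
  "holomorphic_self_map S f \<longleftrightarrow> f holomorphic_on S \<and> f \<in> S \<rightarrow> S"

definition holomorphic_automorphism :: "complex set \<Rightarrow> (complex \<Rightarrow> complex) \<Rightarrow> bool" where
  "holomorphic_automorphism S f \<longleftrightarrow>
     holomorphic_self_map S f \<and>
     (\<exists>g. holomorphic_self_map S g \<and> (\<forall>z\<in>S. g (f z) = z) \<and> (\<forall>z\<in>S. f (g z) = z))"

text \<open>The hyperbolic derivative \<open>f\<^sup>h\<close>, meaningful for holomorphic self-maps \<open>f\<close> of the
  unit disk and points \<open>z\<close> of the unit disk.\<close>

definition hyp_deriv :: "(complex \<Rightarrow> complex) \<Rightarrow> complex \<Rightarrow> real" where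
  "hyp_deriv f z = (1 - (norm z)\<^sup>2) * (norm (deriv f z) / (1 - (norm (f z))\<^sup>2))"

definition locally_uniform_limit ::
    "'a::topological_space set \<Rightarrow> ('b \<Rightarrow> 'a \<Rightarrow> 'c::metric_space) \<Rightarrow> ('a \<Rightarrow> 'c) \<Rightarrow> 'b filter \<Rightarrow> bool" where
  "locally_uniform_limit S f l F \<longleftrightarrow>
     (\<forall>x\<in>S. \<exists>U. openin (top_of_set S) U \<and> x \<in> U \<and> uniform_limit U f l F)"

end

theory Submission
  imports Defs
begin

text \<open>After composing with a disk automorphism, assume \<open>f 0 = 0\<close> and write \<open>f z = z * h z\<close>.
  The Schwarz-Pick lemma for \<open>h\<close> gives \<open>f\<^sup>h z \<le> (b + r) / (1 + r b)\<close> where \<open>r = \<bar>z\<bar>\<close> and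
  \<open>b = \<bar>h z\<bar>\<close>, while \<open>b\<close> itself is bounded in terms of \<open>\<bar>h 0\<bar> = f\<^sup>h 0\<close> and \<open>r\<close>. This yields
  the boundary estimate \<open>(1 - f\<^sup>h 0) (1 - \<bar>z\<bar>)\<^sup>2 \<le> 4 (1 - f\<^sup>h z)\<close>, in which the roles of
  \<open>0\<close> and \<open>z\<close> can be exchanged by an automorphism. The hypothesis forces \<open>f\<^sub>n\<^sup>h 0\<close> to tend to \<open>1\<close>,
  and the exchanged estimate spreads this to all compact subsets. A subsequential limit that is
  not a unimodular constant has hyperbolic derivative \<open>1\<close> at \<open>0\<close>, so it is an automorphism by the
  equality case of the Schwarz lemma.\<close>

section \<open>Self-maps of the disk and the chain rule for the hyperbolic derivative\<close>

lemma holomorphic_self_map_disk_norm_less: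
  "holomorphic_self_map unit_disk f \<Longrightarrow> norm z < 1 \<Longrightarrow> norm (f z) < 1"
  by (auto simp: holomorphic_self_map_def Pi_iff)

lemma holomorphic_self_map_comp:
  assumes "holomorphic_self_map S f" "holomorphic_self_map S g"
  shows "holomorphic_self_map S (f \<circ> g)"
proof -
  have "f \<circ> g holomorphic_on S"
    using assms
    by (intro holomorphic_on_compose_gen[of g S f S]) (auto simp: holomorphic_self_map_def)
  then show ?thesis
    using assms by (auto simp: holomorphic_self_map_def Pi_iff)
qed

lemma holomorphic_self_map_disk_Moebius:
  "norm w < 1 \<Longrightarrow> holomorphic_self_map unit_disk (Moebius_function 0 w)"
  by (simp add: holomorphic_self_map_def Moebius_function_holomorphic Moebius_function_norm_lt_1)

lemma hyp_deriv_nonneg: "norm z < 1 \<Longrightarrow> norm (f z) < 1 \<Longrightarrow> 0 \<le> hyp_deriv f z"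
  unfolding hyp_deriv_def
  by (intro mult_nonneg_nonneg divide_nonneg_nonneg) (auto simp: power_le_one)

text \<open>Moebius maps with opposite parameters are known to cancel only inside the disk. Since
  the disk is open, agreement there already determines derivatives, so such compositions can be
  treated as the identity.\<close>

lemma hyp_deriv_cong:
  assumes "\<And>w. norm w < 1 \<Longrightarrow> f w = g w" "norm z < 1"
  shows "hyp_deriv f z = hyp_deriv g z"
proof -
  have "\<forall>\<^sub>F w in nhds z. f w = g w"
    using assms by (intro eventually_nhds_in_open[of unit_disk z, THEN eventually_mono]) auto
  then have "deriv f z = deriv g z"
    by (rule deriv_cong_ev) simp
  then show ?thesis
    using assms by (simp add: hyp_deriv_def)
qed

text \<open>The factor \<open>1 - |g z|^2\<close> occurs as weight at \<open>g z\<close> and as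
  denominator for \<open>g\<close> at \<open>z\<close>; being nonzero it cancels, and the ordinary
  chain rule remains.\<close>

lemma hyp_deriv_comp:
  assumes "f holomorphic_on unit_disk" "holomorphic_self_map unit_disk g" "norm z < 1"
  shows "hyp_deriv (f \<circ> g) z = hyp_deriv f (g z) * hyp_deriv g z"
proof -
  have gz: "norm (g z) < 1"
    using assms holomorphic_self_map_disk_norm_less by blast
  have "f field_differentiable at (g z)" "g field_differentiable at z"
    using assms gz
    by (auto simp: holomorphic_self_map_def intro!: holomorphic_on_imp_differentiable_at[of _ unit_disk])
  then have "deriv (f \<circ> g) z = deriv f (g z) * deriv g z"
    by (rule deriv_chain[rotated])
  moreover have "1 - (norm (g z))\<^sup>2 \<noteq> 0"
    using gz by (simp add: power2_eq_1_iff) (smt (verit) norm_ge_zero)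
  ultimately show ?thesis
    by (simp add: hyp_deriv_def norm_mult)
qed

section \<open>Moebius maps and the Schwarz-Pick lemma\<close>

lemma hyp_deriv_Moebius_0:
  assumes "norm w < 1"
  shows "hyp_deriv (Moebius_function 0 w) 0 = 1"
proof -
  have "((\<lambda>z. (z - w) / (1 - cnj w * z)) has_field_derivative 1 - w * cnj w) (at 0)"
    by (auto intro!: derivative_eq_intros simp: field_simps)
  moreover have "Moebius_function 0 w = (\<lambda>z. (z - w) / (1 - cnj w * z))"
    by (simp add: fun_eq_iff Moebius_function_simple)
  ultimately have "deriv (Moebius_function 0 w) 0 = of_real (1 - (norm w)\<^sup>2)"
    by (simp add: DERIV_imp_deriv flip: complex_norm_square)
  moreover have "(norm w)\<^sup>2 < 1"
    using assms by (simp add: power_less_one_iff)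
  ultimately show ?thesis
    by (simp add: hyp_deriv_def Moebius_function_of_zero del: of_real_diff)
qed

text \<open>Chain rule at \<open>0\<close> for the inverse pair with parameters \<open>w\<close> and
  \<open>- w\<close>: the inner map sends \<open>0\<close> to \<open>w\<close> and has hyperbolic
  derivative \<open>1\<close> there, and so does the composite, the identity.\<close>

lemma hyp_deriv_Moebius_self:
  assumes "norm w < 1"
  shows "hyp_deriv (Moebius_function 0 w) w = 1"
proof -
  have w0: "Moebius_function 0 (- w) 0 = w"
    by (simp add: Moebius_function_of_zero)
  have "hyp_deriv (Moebius_function 0 w \<circ> Moebius_function 0 (- w)) 0 = hyp_deriv (\<lambda>z. z) 0"
    using assms by (intro hyp_deriv_cong) (auto simp: Moebius_function_compose)
  also have "\<dots> = 1"
    by (simp add: hyp_deriv_def)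
  finally show ?thesis
    using hyp_deriv_comp[OF Moebius_function_holomorphic[OF assms, of 0]
        holomorphic_self_map_disk_Moebius[of "- w"], of 0] assms w0
    by (simp add: hyp_deriv_Moebius_0)
qed

text \<open>Moving \<open>f 0\<close> to \<open>0\<close> by a Moebius map leaves the hyperbolic
  derivative at \<open>0\<close> unchanged and turns it into the modulus of an ordinary derivative,
  to which the Schwarz lemma applies.\<close>

lemma Schwarz_Pick_0:
  assumes "holomorphic_self_map unit_disk f"
  shows "hyp_deriv f 0 \<le> 1"
proof -
  define F where "F = Moebius_function 0 (f 0) \<circ> f"
  have f0: "norm (f 0) < 1"
    using assms holomorphic_self_map_disk_norm_less[of f 0] by simp
  have F: "holomorphic_self_map unit_disk F" and F0: "F 0 = 0"
    using assms f0 by (auto simp: F_def Moebius_function_eq_zero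
        intro!: holomorphic_self_map_comp holomorphic_self_map_disk_Moebius)
  have "norm (deriv F 0) \<le> 1"
    using F F0 holomorphic_self_map_disk_norm_less[OF F]
    by (intro Schwarz_Lemma(2)[where \<xi>=0]) (auto simp: holomorphic_self_map_def)
  moreover have "hyp_deriv F 0 = norm (deriv F 0)"
    by (simp add: hyp_deriv_def F0)
  moreover have "hyp_deriv F 0 = hyp_deriv f 0"
    using assms f0 by (simp add: F_def hyp_deriv_comp Moebius_function_holomorphic hyp_deriv_Moebius_self)
  ultimately show ?thesis
    by simp
qed

lemma Schwarz_Pick:
  assumes "holomorphic_self_map unit_disk f" "norm z < 1"
  shows "hyp_deriv f z \<le> 1"
proof -
  define k where "k = f \<circ> Moebius_function 0 (- z)"
  have "holomorphic_self_map unit_disk k"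
    using assms by (auto simp: k_def intro!: holomorphic_self_map_comp holomorphic_self_map_disk_Moebius)
  then have "hyp_deriv k 0 \<le> 1"
    by (rule Schwarz_Pick_0)
  moreover have "hyp_deriv k 0 = hyp_deriv f z"
    using assms unfolding k_def
    by (subst hyp_deriv_comp)
      (auto simp: holomorphic_self_map_disk_Moebius hyp_deriv_Moebius_0 Moebius_function_of_zero
        holomorphic_self_map_def[of _ f])
  ultimately show ?thesis
    by simp
qed

text \<open>By the chain rule the hyperbolic derivatives of a Moebius map and its inverse multiply
  to \<open>1\<close>. Neither exceeds \<open>1\<close> by Schwarz-Pick, so both are
  \<open>1\<close>.\<close>

lemma hyp_deriv_Moebius:
  assumes "norm w < 1" "norm z < 1"
  shows "hyp_deriv (Moebius_function 0 w) z = 1"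
proof -
  define M N where "M = Moebius_function 0 w" and "N = Moebius_function 0 (- w)"
  have MN: "holomorphic_self_map unit_disk M" "holomorphic_self_map unit_disk N"
    using assms by (simp_all add: M_def N_def holomorphic_self_map_disk_Moebius)
  have Mz: "norm (M z) < 1"
    using assms MN by (simp add: holomorphic_self_map_disk_norm_less)
  have "hyp_deriv (N \<circ> M) z = hyp_deriv (\<lambda>z. z) z"
    using assms by (intro hyp_deriv_cong) (auto simp: M_def N_def Moebius_function_compose)
  also have "\<dots> = 1"
    using assms by (simp add: hyp_deriv_def power2_eq_1_iff) (smt (verit) norm_ge_zero)
  finally have "hyp_deriv N (M z) * hyp_deriv M z = 1"
    using MN assms by (simp add: hyp_deriv_comp holomorphic_self_map_def[of _ N])
  moreover have "hyp_deriv N (M z) * hyp_deriv M z \<le> 1 * hyp_deriv M z"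
    using Schwarz_Pick[OF MN(2) Mz] hyp_deriv_nonneg[of z M] assms Mz
    by (intro mult_right_mono) auto
  moreover have "hyp_deriv M z \<le> 1"
    using MN(1) assms(2) by (rule Schwarz_Pick)
  ultimately show ?thesis
    by (simp add: M_def)
qed

section \<open>Growth of disk self-maps and the maximum modulus principle\<close>

text \<open>With \<open>K = (1 - |w|^2) (1 - |z|^2)\<close> the squared modulus equals
  \<open>1 - K / |1 - cnj w * z|^2\<close>, which increases with the denominator. Replacing
  \<open>|1 - cnj w * z|\<close> by its upper bound \<open>1 + |w| |z|\<close> yields the square of
  the right-hand side.\<close>

lemma norm_Moebius_le:
  assumes "norm w < 1" "norm z < 1"
  shows "norm (Moebius_function 0 w z) \<le> (norm w + norm z) / (1 + norm w * norm z)"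
proof -
  define a r where "a = norm w" and "r = norm z"
  define N D where "N = norm (z - w)" and "D = norm (1 - cnj w * z)"
  have ar: "0 \<le> a" "a < 1" "0 \<le> r" "r < 1"
    using assms by (auto simp: a_def r_def)
  have id: "D\<^sup>2 - N\<^sup>2 = (1 - a\<^sup>2) * (1 - r\<^sup>2)"
    unfolding N_def D_def a_def r_def cmod_power2
    by (simp add: algebra_simps power2_eq_square)
  have pos: "(1 - a\<^sup>2) * (1 - r\<^sup>2) > 0"
    using ar by (intro mult_pos_pos) (auto simp: power_less_one_iff)
  have D: "0 \<le> D" "0 \<le> N" "D \<le> 1 + a * r"
    unfolding D_def N_def using norm_triangle_ineq4[of 1 "cnj w * z"] by (auto simp: norm_mult a_def r_def)
  have "D \<noteq> 0"
    using id pos by (metis diff_0 neg_0_less_iff_less not_less zero_eq_power2 zero_le_power2)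
  with D have D0: "0 < D" by simp
  have "N\<^sup>2 * (1 + a * r)\<^sup>2 \<le> (a + r)\<^sup>2 * D\<^sup>2"
  proof -
    define K where "K = (1 - a\<^sup>2) * (1 - r\<^sup>2)"
    have "D\<^sup>2 \<le> (1 + a * r)\<^sup>2"
      using D by (intro power_mono) auto
    then have "K * D\<^sup>2 \<le> K * (1 + a * r)\<^sup>2"
      using pos unfolding K_def by (intro mult_left_mono) auto
    moreover have "(a + r)\<^sup>2 = (1 + a * r)\<^sup>2 - K"
      by (simp add: K_def algebra_simps power2_eq_square)
    moreover have "N\<^sup>2 = D\<^sup>2 - K"
      using id by (simp add: K_def)
    ultimately show ?thesis
      by (simp add: left_diff_distrib right_diff_distrib mult.commute)
  qed
  then have "(N * (1 + a * r))\<^sup>2 \<le> ((a + r) * D)\<^sup>2"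
    by (simp add: power_mult_distrib)
  then have "N * (1 + a * r) \<le> (a + r) * D"
    by (rule power2_le_imp_le) (use ar D in auto)
  moreover have "1 + a * r > 0"
    using ar by (simp add: add_pos_nonneg)
  ultimately have "N / D \<le> (a + r) / (1 + a * r)"
    using D0 by (simp add: divide_simps)
  then show ?thesis
    by (simp add: Moebius_function_simple norm_divide N_def D_def a_def r_def)
qed

text \<open>After normalizing \<open>f 0\<close> to \<open>0\<close>, the Schwarz lemma bounds the
  modulus by \<open>|z|\<close>; undoing the normalization costs only what
  \<open>norm_Moebius_le\<close> allows.\<close>

lemma holomorphic_self_map_disk_growth:
  assumes "holomorphic_self_map unit_disk f" "norm z < 1"
  shows "(1 - norm (f 0)) * (1 - norm z) \<le> 2 * (1 - norm (f z))"
proof -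
  define F where "F = Moebius_function 0 (f 0) \<circ> f"
  define a r u where "a = norm (f 0)" and "r = norm z" and "u = norm (F z)"
  have f0: "norm (f 0) < 1"
    using assms holomorphic_self_map_disk_norm_less[of f 0] by simp
  have F: "holomorphic_self_map unit_disk F" and F0: "F 0 = 0"
    using assms f0 by (auto simp: F_def Moebius_function_eq_zero
        intro!: holomorphic_self_map_comp holomorphic_self_map_disk_Moebius)
  have ur: "u \<le> r"
    unfolding u_def r_def using assms F F0 holomorphic_self_map_disk_norm_less[OF F]
    by (intro Schwarz_Lemma(1)) (auto simp: holomorphic_self_map_def)
  have bounds: "0 \<le> a" "a < 1" "0 \<le> u" "r < 1"
    using f0 assms by (auto simp: a_def u_def r_def)
  have "f z = Moebius_function 0 (- f 0) (F z)"
    using assms f0 holomorphic_self_map_disk_norm_less[of f z] by (simp add: F_def Moebius_function_compose)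
  then have "norm (f z) \<le> (a + u) / (1 + a * u)"
    using norm_Moebius_le[of "- f 0" "F z"] f0 ur bounds by (simp add: a_def u_def)
  then have "norm (f z) * (1 + a * u) \<le> a + u"
    using bounds by (simp add: pos_le_divide_eq add_pos_nonneg)
  \<comment> \<open>This uses \<open>(1 + a * u) - (a + u) = (1 - a) * (1 - u)\<close>. The constant
    2 of the lemma then comes from \<open>1 + a * u \<le> 2\<close>.\<close>
  then have "(1 - a) * (1 - u) \<le> (1 - norm (f z)) * (1 + a * u)"
    by (simp add: algebra_simps)
  also have "\<dots> \<le> (1 - norm (f z)) * 2"
  proof (rule mult_left_mono)
    have "a * u \<le> 1 * 1"
      using bounds ur by (intro mult_mono) auto
    then show "1 + a * u \<le> 2" by simp
  qed (use assms holomorphic_self_map_disk_norm_less[of f z] in simp)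
  finally have "(1 - a) * (1 - u) \<le> 2 * (1 - norm (f z))" by simp
  moreover have "(1 - a) * (1 - r) \<le> (1 - a) * (1 - u)"
    using bounds ur by (intro mult_left_mono) auto
  ultimately show ?thesis
    by (simp add: a_def r_def)
qed

text \<open>If the modulus attains \<open>1\<close> inside the disk, the maximum modulus principle
  makes the map constant. The dichotomy serves both the Schwarz quotient \<open>f z / z\<close> and
  the limit functions.\<close>

lemma holomorphic_disk_bounded_cases:
  assumes "g holomorphic_on unit_disk" "\<And>z. norm z < 1 \<Longrightarrow> norm (g z) \<le> 1"
  shows "holomorphic_self_map unit_disk g \<or> (\<exists>c. norm c = 1 \<and> (\<forall>z\<in>unit_disk. g z = c))"
proof (cases "\<forall>z. norm z < 1 \<longrightarrow> norm (g z) < 1")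
  case True
  then show ?thesis
    using assms by (auto simp: holomorphic_self_map_def)
next
  case False
  then obtain \<xi> where \<xi>: "norm \<xi> < 1" "norm (g \<xi>) = 1"
    using assms(2) by force
  then have "g constant_on unit_disk"
    using assms by (intro maximum_modulus_principle[of g unit_disk unit_disk \<xi>]) auto
  then show ?thesis
    using \<xi> by (metis constant_on_def mem_ball_0)
qed

section \<open>Boundary estimates for the hyperbolic derivative\<close>

lemma hyp_deriv_boundary_bound_fixing_0:
  assumes f: "holomorphic_self_map unit_disk f" and f0: "f 0 = 0" and z: "norm z < 1"
  shows "(1 - hyp_deriv f 0) * (1 - norm z)\<^sup>2 \<le> 4 * (1 - hyp_deriv f z)"
proof -
  have "f holomorphic_on unit_disk"
    using f by (simp add: holomorphic_self_map_def)
  then obtain h where h: "h holomorphic_on unit_disk" "\<And>z. norm z < 1 \<Longrightarrow> f z = z * h z"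
    and h0: "deriv f 0 = h 0"
    using f0 by (rule Schwarz3) blast
  have hd0: "hyp_deriv f 0 = norm (h 0)"
    by (simp add: hyp_deriv_def f0 h0)
  \<comment> \<open>At \<open>0\<close> the quotient equals the derivative of \<open>f\<close>,
    which is bounded by Schwarz-Pick; elsewhere the Schwarz lemma is divided by
    \<open>|w|\<close>.\<close>
  have "norm (h w) \<le> 1" if "norm w < 1" for w
  proof (cases "w = 0")
    case True
    then show ?thesis
      using Schwarz_Pick_0[OF f] hd0 by simp
  next
    case False
    have "norm (f w) \<le> norm w"
      using that f f0 holomorphic_self_map_disk_norm_less[OF f]
      by (intro Schwarz_Lemma(1)) (auto simp: holomorphic_self_map_def)
    then show ?thesis
      using False that h(2)[of w] by (simp add: norm_mult)
  qed
  with h(1) consider "holomorphic_self_map unit_disk h" | c where "norm c = 1" "\<forall>z\<in>unit_disk. h z = c"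
    using holomorphic_disk_bounded_cases by blast
  then show ?thesis
  proof cases
    \<comment> \<open>Here \<open>f\<close> is a rotation on the disk and
      \<open>hyp_deriv f 0 = 1\<close>, so the left side vanishes and Schwarz-Pick makes the right
      side nonnegative.\<close>
    case (2 c)
    then show ?thesis
      using hd0 Schwarz_Pick[OF f z] by simp
  next
    case 1
    define a b r d where "a = norm (h 0)" and "b = norm (h z)" and "r = norm z"
      and "d = norm (deriv h z)"
    have bounds: "0 \<le> b" "b < 1" "0 \<le> r" "r < 1"
      using z holomorphic_self_map_disk_norm_less[OF 1 z] by (auto simp: b_def r_def)
    have sq: "r\<^sup>2 < 1" "b\<^sup>2 < 1"
      using bounds by (auto simp: power_less_one_iff)
    have rb: "r * b < 1"
      using bounds mult_strict_mono[of r 1 b 1] by auto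
    have "(1 - r\<^sup>2) * (d / (1 - b\<^sup>2)) \<le> 1"
      using Schwarz_Pick[OF 1 z] by (simp add: hyp_deriv_def r_def b_def d_def)
    then have d: "(1 - r\<^sup>2) * d \<le> 1 - b\<^sup>2"
      using sq by (simp add: divide_simps)
    have "((\<lambda>w. w * h w) has_field_derivative h z + z * deriv h z) (at z)"
      using holomorphic_derivI[OF h(1) open_ball, of z] z
      by (auto intro!: derivative_eq_intros)
    moreover have "deriv f z = deriv (\<lambda>w. w * h w) z"
      using h(2) z
      by (intro deriv_cong_ev eventually_nhds_in_open[of unit_disk z, THEN eventually_mono]) auto
    ultimately have "deriv f z = h z + z * deriv h z"
      by (simp add: DERIV_imp_deriv)
    then have "norm (deriv f z) \<le> b + r * d"
      using norm_triangle_ineq[of "h z" "z * deriv h z"] by (simp add: norm_mult b_def r_def d_def)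
    \<comment> \<open>The weight \<open>1 - r^2\<close> lets Schwarz-Pick for \<open>h\<close>
      replace \<open>d\<close>. The resulting bound factors, and its factor \<open>1 - r * b\<close>
      cancels against \<open>1 - |f z|^2 = (1 - r * b) * (1 + r * b)\<close>.\<close>
    then have "(1 - r\<^sup>2) * norm (deriv f z) \<le> (1 - r\<^sup>2) * (b + r * d)"
      using sq by (intro mult_left_mono) auto
    also have "\<dots> = (1 - r\<^sup>2) * b + r * ((1 - r\<^sup>2) * d)"
      by (simp add: algebra_simps)
    also have "\<dots> \<le> (1 - r\<^sup>2) * b + r * (1 - b\<^sup>2)"
      using d bounds by (intro add_left_mono mult_left_mono) auto
    also have "\<dots> = (b + r) * (1 - r * b)"
      by (simp add: algebra_simps power2_eq_square)
    finally have num: "(1 - r\<^sup>2) * norm (deriv f z) \<le> (b + r) * (1 - r * b)" .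
    have den: "1 - (norm (f z))\<^sup>2 = (1 - r * b) * (1 + r * b)"
      using h(2)[OF z] by (simp add: norm_mult r_def b_def algebra_simps power2_eq_square)
    have rb0: "0 \<le> r * b"
      using bounds by simp
    have "hyp_deriv f z = ((1 - r\<^sup>2) * norm (deriv f z)) / ((1 - r * b) * (1 + r * b))"
      by (simp add: hyp_deriv_def den r_def)
    also have "\<dots> \<le> ((b + r) * (1 - r * b)) / ((1 - r * b) * (1 + r * b))"
      using num rb rb0 by (intro divide_right_mono) auto
    also have "\<dots> = (b + r) / (1 + r * b)"
      using rb by simp
    finally have "hyp_deriv f z * (1 + r * b) \<le> b + r"
      using rb0 by (simp add: pos_le_divide_eq add_pos_nonneg)
    \<comment> \<open>This uses \<open>(1 + r * b) - (b + r) = (1 - b) * (1 - r)\<close>.\<close>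
    then have "(1 - b) * (1 - r) \<le> (1 - hyp_deriv f z) * (1 + r * b)"
      by (simp add: algebra_simps)
    also have "\<dots> \<le> (1 - hyp_deriv f z) * 2"
      using Schwarz_Pick[OF f z] rb by (intro mult_left_mono) auto
    finally have "2 * ((1 - b) * (1 - r)) \<le> 4 * (1 - hyp_deriv f z)"
      by simp
    \<comment> \<open>Growth of \<open>h\<close> trades \<open>1 - b\<close> for
      \<open>1 - a\<close> at the price of a second factor \<open>1 - r\<close>, hence the square,
      and of a second factor 2, hence the constant 4.\<close>
    moreover have "((1 - a) * (1 - r)) * (1 - r) \<le> (2 * (1 - b)) * (1 - r)"
      using holomorphic_self_map_disk_growth[OF 1 z] bounds
      by (intro mult_right_mono) (auto simp: a_def b_def r_def)
    ultimately show ?thesis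
      by (simp add: hd0 a_def r_def power2_eq_square algebra_simps)
  qed
qed

text \<open>Postcomposition with a Moebius map preserves the hyperbolic derivative at every point,
  so \<open>f 0 = 0\<close> can be arranged.\<close>

lemma hyp_deriv_boundary_bound:
  assumes f: "holomorphic_self_map unit_disk f" and z: "norm z < 1"
  shows "(1 - hyp_deriv f 0) * (1 - norm z)\<^sup>2 \<le> 4 * (1 - hyp_deriv f z)"
proof -
  define F where "F = Moebius_function 0 (f 0) \<circ> f"
  have f0: "norm (f 0) < 1"
    using f holomorphic_self_map_disk_norm_less[of f 0] by simp
  have M: "holomorphic_self_map unit_disk (Moebius_function 0 (f 0))"
    using f0 by (rule holomorphic_self_map_disk_Moebius)
  have F: "holomorphic_self_map unit_disk F" and F0: "F 0 = 0"
    using f M by (auto simp: F_def Moebius_function_eq_zero intro!: holomorphic_self_map_comp)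
  have chain: "hyp_deriv F w = hyp_deriv (Moebius_function 0 (f 0)) (f w) * hyp_deriv f w"
    if "norm w < 1" for w
    using that f M unfolding F_def by (intro hyp_deriv_comp) (auto simp: holomorphic_self_map_def)
  have "hyp_deriv F w = hyp_deriv f w" if "norm w < 1" for w
    using that f f0 by (simp add: chain hyp_deriv_Moebius holomorphic_self_map_disk_norm_less)
  then show ?thesis
    using hyp_deriv_boundary_bound_fixing_0[OF F F0 z] z by simp
qed

text \<open>The Moebius map with parameter \<open>- z\<close> sends \<open>0\<close> to
  \<open>z\<close> and \<open>- z\<close> to \<open>0\<close>. Precomposing with it swaps the two
  base points, while \<open>|- z| = |z|\<close> keeps the weight.\<close>

lemma hyp_deriv_boundary_bound_exchanged:
  assumes f: "holomorphic_self_map unit_disk f" and z: "norm z < 1"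
  shows "(1 - hyp_deriv f z) * (1 - norm z)\<^sup>2 \<le> 4 * (1 - hyp_deriv f 0)"
proof -
  define k where "k = f \<circ> Moebius_function 0 (- z)"
  have M: "holomorphic_self_map unit_disk (Moebius_function 0 (- z))"
    using z by (simp add: holomorphic_self_map_disk_Moebius)
  have k: "holomorphic_self_map unit_disk k"
    using f M by (auto simp: k_def intro!: holomorphic_self_map_comp)
  have chain: "hyp_deriv k w =
      hyp_deriv f (Moebius_function 0 (- z) w) * hyp_deriv (Moebius_function 0 (- z)) w"
    if "norm w < 1" for w
    using that f M unfolding k_def by (intro hyp_deriv_comp) (auto simp: holomorphic_self_map_def)
  have "hyp_deriv k 0 = hyp_deriv f z"
    using z by (simp add: chain hyp_deriv_Moebius_0 Moebius_function_of_zero)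
  moreover have "hyp_deriv k (- z) = hyp_deriv f 0"
    using z by (simp add: chain hyp_deriv_Moebius_self Moebius_function_eq_zero)
  ultimately show ?thesis
    using hyp_deriv_boundary_bound[OF k, of "- z"] z by simp
qed

section \<open>Rigidity when the hyperbolic derivative equals one\<close>

lemma holomorphic_automorphism_if_hyp_deriv_eq_1:
  assumes f: "holomorphic_self_map unit_disk f" and "hyp_deriv f 0 = 1"
  shows "holomorphic_automorphism unit_disk f"
proof -
  define M where "M = Moebius_function 0 (f 0)"
  define F where "F = M \<circ> f"
  have f0: "norm (f 0) < 1"
    using f holomorphic_self_map_disk_norm_less[of f 0] by simp
  have M: "holomorphic_self_map unit_disk M"
    unfolding M_def using f0 by (rule holomorphic_self_map_disk_Moebius)
  have F: "holomorphic_self_map unit_disk F" and F0: "F 0 = 0"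
    using f M by (auto simp: F_def M_def Moebius_function_eq_zero intro!: holomorphic_self_map_comp)
  have "hyp_deriv F 0 = 1"
    using assms f0 by (simp add: F_def M_def hyp_deriv_comp Moebius_function_holomorphic hyp_deriv_Moebius_self)
  then have "norm (deriv F 0) = 1"
    by (simp add: hyp_deriv_def F0)
  then have "\<exists>\<alpha>. (\<forall>z. norm z < 1 \<longrightarrow> F z = \<alpha> * z) \<and> norm \<alpha> = 1"
    using F F0 holomorphic_self_map_disk_norm_less[OF F]
    by (intro Schwarz_Lemma(3)[where \<xi>=0]) (auto simp: holomorphic_self_map_def)
  then obtain \<alpha> where \<alpha>: "\<And>z. norm z < 1 \<Longrightarrow> F z = \<alpha> * z" "norm \<alpha> = 1"
    by blast
  have \<alpha>cnj: "\<alpha> * cnj \<alpha> = 1" "cnj \<alpha> * \<alpha> = 1"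
    using \<alpha>(2) by (simp_all add: mult.commute flip: complex_norm_square)
  \<comment> \<open>Equality in the Schwarz lemma makes \<open>M \<circ> f\<close> the rotation by
    \<open>\<alpha>\<close>; solving \<open>M (f z) = \<alpha> * z\<close> for \<open>z\<close>
    gives this inverse.\<close>
  define g where "g z = cnj \<alpha> * M z" for z
  have g: "holomorphic_self_map unit_disk g"
    using M \<alpha>(2) unfolding g_def holomorphic_self_map_def
    by (auto simp: norm_mult Pi_iff intro!: holomorphic_intros)
  have "g (f z) = z" if "norm z < 1" for z
    using \<alpha>(1)[OF that] \<alpha>cnj by (simp add: g_def F_def flip: mult.assoc)
  moreover have "f (g z) = z" if z: "norm z < 1" for z
  proof -
    have gz: "norm (g z) < 1"
      using g z by (rule holomorphic_self_map_disk_norm_less)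
    \<comment> \<open>It remains to cancel \<open>M\<close>, which is injective on the disk because
      the Moebius map with parameter \<open>- f 0\<close> inverts it there.\<close>
    have "M (f (g z)) = M z"
      using \<alpha>(1)[OF gz] \<alpha>cnj by (simp add: g_def F_def flip: mult.assoc)
    then show ?thesis
      using Moebius_function_compose[of "- f 0" "f 0"] f0 z f gz
      by (metis M_def holomorphic_self_map_disk_norm_less minus_minus norm_minus_cancel)
  qed
  ultimately show ?thesis
    using f g by (auto simp: holomorphic_automorphism_def)
qed

section \<open>Locally uniform convergence and limit functions\<close>

text \<open>Passes to closed balls, the form in which the convergence theorems for holomorphic
  sequences take uniform convergence.\<close>

lemma locally_uniform_limit_cball:
  fixes S :: "'a::metric_space set"
  assumes "locally_uniform_limit S f l F" "open S" "x \<in> S"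
  obtains d where "0 < d" "cball x d \<subseteq> S" "uniform_limit (cball x d) f l F"
proof -
  obtain U where U: "openin (top_of_set S) U" "x \<in> U" "uniform_limit U f l F"
    using assms by (auto simp: locally_uniform_limit_def)
  then have "open U" "U \<subseteq> S"
    using \<open>open S\<close> by (auto simp: openin_open_eq)
  with U(2) obtain d where "0 < d" "cball x d \<subseteq> U"
    by (auto simp: open_contains_cball)
  with U(3) \<open>U \<subseteq> S\<close> show ?thesis
    by (intro that) (auto intro: uniform_limit_on_subset)
qed

lemma locally_uniform_limit_hyp_deriv_1:
  assumes f: "\<And>n. holomorphic_self_map unit_disk (f n)"
    and lim: "(\<lambda>n. hyp_deriv (f n) 0) \<longlonglongrightarrow> 1"
  shows "locally_uniform_limit unit_disk (\<lambda>n. hyp_deriv (f n)) (\<lambda>_. 1) sequentially"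
  unfolding locally_uniform_limit_def
proof
  fix x :: complex assume x: "x \<in> unit_disk"
  \<comment> \<open>A radius strictly between \<open>|x|\<close> and \<open>1\<close>: the ball of
    radius \<open>R\<close> contains \<open>x\<close>, and \<open>1 - |w|\<close> stays above
    \<open>1 - R > 0\<close> on it, which makes the exchanged estimate uniform.\<close>
  define R where "R = (1 + norm x) / 2"
  have R: "norm x < R" "R < 1"
    using x by (auto simp: R_def)
  have "(\<lambda>n. 4 * (1 - hyp_deriv (f n) 0) / (1 - R)\<^sup>2) \<longlonglongrightarrow> 4 * (1 - 1) / (1 - R)\<^sup>2"
    using lim R by (intro tendsto_intros) auto
  then have tends: "(\<lambda>n. 4 * (1 - hyp_deriv (f n) 0) / (1 - R)\<^sup>2) \<longlonglongrightarrow> 0"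
    by simp
  have bound: "dist (hyp_deriv (f n) w) 1 \<le> 4 * (1 - hyp_deriv (f n) 0) / (1 - R)\<^sup>2"
    if w: "norm w < R" for n w
  proof -
    have w1: "norm w < 1"
      using w R by simp
    have SP: "hyp_deriv (f n) w \<le> 1"
      using f w1 by (rule Schwarz_Pick)
    have "(1 - hyp_deriv (f n) w) * (1 - R)\<^sup>2 \<le> (1 - hyp_deriv (f n) w) * (1 - norm w)\<^sup>2"
      using SP w R by (intro mult_left_mono power_mono) auto
    also have "\<dots> \<le> 4 * (1 - hyp_deriv (f n) 0)"
      using f w1 by (rule hyp_deriv_boundary_bound_exchanged)
    finally have "1 - hyp_deriv (f n) w \<le> 4 * (1 - hyp_deriv (f n) 0) / (1 - R)\<^sup>2"
      using R by (simp add: pos_le_divide_eq)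
    then show ?thesis
      using SP by (simp add: dist_real_def)
  qed
  have "uniform_limit (ball 0 R) (\<lambda>n. hyp_deriv (f n)) (\<lambda>_. 1) sequentially"
  proof (rule uniform_limitI)
    fix e :: real assume "0 < e"
    with tends have "\<forall>\<^sub>F n in sequentially. 4 * (1 - hyp_deriv (f n) 0) / (1 - R)\<^sup>2 < e"
      by (rule order_tendstoD)
    then show "\<forall>\<^sub>F n in sequentially. \<forall>w\<in>ball 0 R. dist (hyp_deriv (f n) w) 1 < e"
      by eventually_elim (auto intro: le_less_trans[OF bound])
  qed
  moreover have "openin (top_of_set unit_disk) (ball 0 R)"
    using R by (auto simp: openin_open_eq)
  ultimately show "\<exists>U. openin (top_of_set unit_disk) U \<and> x \<in> U \<and>
      uniform_limit U (\<lambda>n. hyp_deriv (f n)) (\<lambda>_. 1) sequentially"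
    using R by (intro exI[of _ "ball 0 R"]) auto
qed

lemma hyp_deriv_limit_cases:
  assumes f: "\<And>n. holomorphic_self_map unit_disk (f n)"
    and lim: "locally_uniform_limit unit_disk f g sequentially"
    and hd: "(\<lambda>n. hyp_deriv (f n) 0) \<longlonglongrightarrow> 1"
  shows "holomorphic_automorphism unit_disk g \<or> (\<exists>c. norm c = 1 \<and> (\<forall>w\<in>unit_disk. g w = c))"
proof -
  have ulim: "\<exists>d>0. cball x d \<subseteq> unit_disk \<and> uniform_limit (cball x d) f g sequentially"
    if "x \<in> unit_disk" for x
    using locally_uniform_limit_cball[OF lim open_ball that] by blast
  have ptw: "(\<lambda>n. f n x) \<longlonglongrightarrow> g x" if x: "norm x < 1" for x
  proof -
    obtain d where "0 < d" "uniform_limit (cball x d) f g sequentially"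
      using ulim[of x] x by auto
    then show ?thesis
      by (auto intro: tendsto_uniform_limitI)
  qed
  have "norm (g x) \<le> 1" if x: "norm x < 1" for x
    using tendsto_norm[OF ptw[OF x]] holomorphic_self_map_disk_norm_less[OF f x]
    by (intro LIMSEQ_le_const2[of "\<lambda>n. norm (f n x)"]) (auto intro: less_imp_le)
  moreover have hol: "f n holomorphic_on unit_disk" for n
    using f by (simp add: holomorphic_self_map_def)
  then have "g holomorphic_on unit_disk"
    using ulim by (intro holomorphic_uniform_sequence[of unit_disk f g]) auto
  ultimately consider "holomorphic_self_map unit_disk g"
    | "\<exists>c. norm c = 1 \<and> (\<forall>w\<in>unit_disk. g w = c)"
    using holomorphic_disk_bounded_cases by blast
  then show ?thesis
  proof cases
    case 1
    \<comment> \<open>Derivatives of the sequence converge along with the maps. As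
      \<open>|g 0| < 1\<close>, the denominators have a nonzero limit, so hyperbolic derivatives at
      \<open>0\<close> converge too and \<open>g\<close> inherits the value
      \<open>1\<close>.\<close>
    obtain g' where g': "\<forall>x\<in>unit_disk. (g has_field_derivative g' x) (at x) \<and> (\<lambda>n. deriv (f n) x) \<longlonglongrightarrow> g' x"
      using has_complex_derivative_uniform_sequence[of unit_disk f "\<lambda>n. deriv (f n)" g]
        holomorphic_derivI[OF hol open_ball] ulim by blast
    then have "(\<lambda>n. deriv (f n) 0) \<longlonglongrightarrow> deriv g 0"
      using DERIV_imp_deriv[of g "g' 0" 0] by simp
    moreover have "(norm (g 0))\<^sup>2 < 1"
      using holomorphic_self_map_disk_norm_less[OF 1, of 0] by (simp add: power_less_one_iff)
    ultimately have "(\<lambda>n. hyp_deriv (f n) 0) \<longlonglongrightarrow> hyp_deriv g 0"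
      unfolding hyp_deriv_def by (intro tendsto_intros ptw) auto
    with hd have "hyp_deriv g 0 = 1"
      using LIMSEQ_unique by blast
    then show ?thesis
      using holomorphic_automorphism_if_hyp_deriv_eq_1[OF 1] by blast
  next
    case 2
    then show ?thesis ..
  qed
qed

theorem corollary4p6:
  fixes f :: "nat \<Rightarrow> complex \<Rightarrow> complex" and z :: "nat \<Rightarrow> complex"
  assumes "\<And>n. holomorphic_self_map unit_disk (f n)"
    and "\<And>n. z n \<in> unit_disk"
    and "(\<lambda>n. norm (z n)) \<longlonglongrightarrow> 1"
    and "(\<lambda>n. hyp_deriv (f n) (z n) - 1) \<in> o(\<lambda>n. (1 - norm (z n))\<^sup>2)"
  shows "locally_uniform_limit unit_disk (\<lambda>n. hyp_deriv (f n)) (\<lambda>_. 1) sequentially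
    \<and> (\<forall>r g. strict_mono (r :: nat \<Rightarrow> nat) \<longrightarrow>
         locally_uniform_limit unit_disk (\<lambda>n. f (r n)) g sequentially \<longrightarrow>
         holomorphic_automorphism unit_disk g \<or>
         (\<exists>c. norm c = 1 \<and> (\<forall>w\<in>unit_disk. g w = c)))"
proof -
  \<comment> \<open>The boundary estimate at \<open>z n\<close> loses exactly the factor
    \<open>(1 - |z n|)^2\<close> that the hypothesis supplies, so the two cancel and only
    convergence to \<open>0\<close> is left.\<close>
  have "(\<lambda>n. 1 - hyp_deriv (f n) 0) \<in> o(\<lambda>_. 1)"
  proof (rule landau_o.smallI)
    fix c :: real assume "c > 0"
    \<comment> \<open>The choice \<open>c / 4\<close> absorbs the constant 4 of the boundary
      estimate.\<close>
    then have "\<forall>\<^sub>F n in sequentially.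
        norm (hyp_deriv (f n) (z n) - 1) \<le> c / 4 * norm ((1 - norm (z n))\<^sup>2)"
      using landau_o.smallD[OF assms(4), of "c / 4"] by simp
    then show "\<forall>\<^sub>F n in sequentially. norm (1 - hyp_deriv (f n) 0) \<le> c * norm (1::real)"
    proof eventually_elim
      case (elim n)
      have zn: "norm (z n) < 1"
        using assms(2)[of n] by simp
      have "(1 - hyp_deriv (f n) 0) * (1 - norm (z n))\<^sup>2 \<le> 4 * (1 - hyp_deriv (f n) (z n))"
        using assms(1) zn by (rule hyp_deriv_boundary_bound)
      also have "\<dots> \<le> c * (1 - norm (z n))\<^sup>2"
        using elim abs_ge_minus_self[of "hyp_deriv (f n) (z n) - 1"] by simp
      finally have "1 - hyp_deriv (f n) 0 \<le> c"
        using zn by simp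
      then show ?case
        using Schwarz_Pick_0[OF assms(1)[of n]] by simp
    qed
  qed
  then have "(\<lambda>n. 1 - (1 - hyp_deriv (f n) 0)) \<longlonglongrightarrow> 1 - 0"
    by (intro tendsto_diff tendsto_const) (auto dest: smalloD_tendsto)
  then have lim: "(\<lambda>n. hyp_deriv (f n) 0) \<longlonglongrightarrow> 1"
    by simp
  \<comment> \<open>Convergence at \<open>0\<close> passes to subsequences, so
    \<open>hyp_deriv_limit_cases\<close> applies to the sequence \<open>f (r n)\<close>
    itself.\<close>
  moreover have "(\<lambda>n. hyp_deriv (f (r n)) 0) \<longlonglongrightarrow> 1" if "strict_mono r" for r :: "nat \<Rightarrow> nat"
    using LIMSEQ_subseq_LIMSEQ[OF lim that] by (simp add: o_def)
  ultimately show ?thesis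
    using locally_uniform_limit_hyp_deriv_1[OF assms(1) lim]
      hyp_deriv_limit_cases[of "\<lambda>n. f (r n)" for r] assms(1) by simp
qed

end
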